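(* For every Hecke pair $(\Gamma,\Lambda)$ with $\Gamma$ locally compact, the subgroup $\Lambda$ almost commutes with compacts.
   Context: Two subgroups of a group are commensurate if their intersection has finite index in both; a subgroup is commensurated if it is commensurate to all its conjugates. A Hecke pair $(\Gamma,\Lambda)$ consists of a Hausdorff topological group $\Gamma$ and an open commensurated subgroup $\Lambda\subseteq\Gamma$. A closed subgroup $\Lambda$ of a locally compact Hausdorff group $\Gamma$ is said to almost commute with compacts if for every compact $C\subseteq\Gamma$ there is a compact $C'\subseteq\Gamma$ such that $C\Lambda\subseteq\Lambda C'$ and $\Lambda C\subseteq C'\Lambda$. *)

theory Defs
  imports "HOL-Algebra.Coset" "HOL-Analysis.Analysis"
begin

definition finite_index_in :: "('a, 'b) monoid_scheme \<Rightarrow> 'a set \<Rightarrow> 'a set \<Rightarrow> bool" where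
  "finite_index_in G K H \<longleftrightarrow>
     subgroup H G \<and> subgroup K G \<and> K \<subseteq> H \<and> finite (rcosets\<^bsub>G\<lparr>carrier := H\<rparr>\<^esub> K)"

definition commensurate :: "('a, 'b) monoid_scheme \<Rightarrow> 'a set \<Rightarrow> 'a set \<Rightarrow> bool" where
  "commensurate G H K \<longleftrightarrow>
     finite_index_in G (H \<inter> K) H \<and> finite_index_in G (H \<inter> K) K"

definition commensurated :: "('a, 'b) monoid_scheme \<Rightarrow> 'a set \<Rightarrow> bool" where
  "commensurated G H \<longleftrightarrow>
     subgroup H G \<and>
     (\<forall>g \<in> carrier G. commensurate G H ((g <#\<^bsub>G\<^esub> H) #>\<^bsub>G\<^esub> inv\<^bsub>G\<^esub> g))"

locale topological_group = group G for G (structure) +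
  fixes T :: "'a topology"
  assumes topspace_eq_carrier: "topspace T = carrier G"
    and continuous_mult: "continuous_map (prod_topology T T) T (\<lambda>(x, y). x \<otimes> y)"
    and continuous_inv: "continuous_map T T (\<lambda>x. inv x)"

locale hecke_pair = topological_group G T for G (structure) and T +
  fixes \<Lambda> :: "'a set"
  assumes Hausdorff: "Hausdorff_space T"
    and open_subgroup: "openin T \<Lambda>"
    and commensurated_subgroup: "commensurated G \<Lambda>"

locale locally_compact_Hausdorff_group = topological_group G T for G (structure) and T +
  assumes Hausdorff: "Hausdorff_space T"
    and locally_compact: "locally_compact_space T"

text \<open>The property is only defined for closed subgroups of locally compact Hausdorff groups,
  so these requirements are part of it.\<close>

definition almost_commutes_with_compacts ::
    "('a, 'b) monoid_scheme \<Rightarrow> 'a topology \<Rightarrow> 'a set \<Rightarrow> bool" where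
  "almost_commutes_with_compacts G T \<Lambda> \<longleftrightarrow>
     locally_compact_Hausdorff_group G T \<and> subgroup \<Lambda> G \<and> closedin T \<Lambda> \<and>
     (\<forall>C. compactin T C \<longrightarrow>
        (\<exists>C'. compactin T C' \<and>
              C <#>\<^bsub>G\<^esub> \<Lambda> \<subseteq> \<Lambda> <#>\<^bsub>G\<^esub> C' \<and>
              \<Lambda> <#>\<^bsub>G\<^esub> C \<subseteq> C' <#>\<^bsub>G\<^esub> \<Lambda>))"

end

theory Submission
  imports Defs
begin

text \<open>The left cosets of the open subgroup \<open>\<Lambda>\<close> are open, so a compact set \<open>C\<close> meets only finitely
  many of them. Each coset \<open>g\<Lambda> = (g\<Lambda>g\<^sup>-\<^sup>1)g\<close> lies in \<open>\<Lambda>F\<close> for a finite set \<open>F\<close>, because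
  \<open>\<Lambda> \<inter> g\<Lambda>g\<^sup>-\<^sup>1\<close> has finite index in \<open>g\<Lambda>g\<^sup>-\<^sup>1\<close>. Hence \<open>C\<Lambda> \<subseteq> \<Lambda>F\<close> with \<open>F\<close> finite. The inclusion for
  \<open>\<Lambda>C\<close> follows by applying this to \<open>C\<^sup>-\<^sup>1\<close> and inverting.\<close>

context group
begin

text \<open>Since \<open>g <# H\<close> is the conjugate \<open>L\<close> translated by
  \<open>g\<close> on the right, and \<open>L\<close> is a finite union of right cosets
  \<open>K #> a\<close> with \<open>K \<subseteq> H\<close>, the elements
  \<open>a \<otimes> g\<close> form the required set \<open>F\<close>.\<close>

lemma commensurated_l_coset_subset:
  assumes "commensurated G H" and g: "g \<in> carrier G"
  obtains F where "finite F" "F \<subseteq> carrier G" "g <# H \<subseteq> H <#> F"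
proof -
  define L where "L = (g <# H) #> inv g"
  define K where "K = H \<inter> L"
  have sH: "subgroup H G" and idx: "finite_index_in G K L"
    using assms by (auto simp: commensurated_def commensurate_def L_def K_def)
  then have sL: "subgroup L G" and sK: "subgroup K G"
    and fin: "finite (rcosets\<^bsub>G\<lparr>carrier := L\<rparr>\<^esub> K)"
    by (auto simp: finite_index_in_def)
  have LG: "L \<subseteq> carrier G" and KG: "K \<subseteq> carrier G" and HG: "H \<subseteq> carrier G"
    using sL sK sH by (auto dest: subgroup.subset)
  \<comment> \<open>Restricting the carrier to \<open>L\<close> leaves multiplication unchanged, so
    the cosets formed in \<open>L\<close> are cosets in \<open>G\<close> of elements of
    \<open>L\<close>.\<close>
  have "rcosets\<^bsub>G\<lparr>carrier := L\<rparr>\<^esub> K = (\<lambda>a. K #> a) ` L"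
    by (auto simp: RCOSETS_def r_coset_def)
  \<comment> \<open>\<open>R\<close> is a finite set of representatives for the right cosets of
    \<open>K\<close> in \<open>L\<close>.\<close>
  with fin obtain R where R: "R \<subseteq> L" "finite R" "(\<lambda>a. K #> a) ` L = (\<lambda>a. K #> a) ` R"
    by (metis finite_subset_image order_refl)
  show thesis
  proof
    show "finite ((\<lambda>a. a \<otimes> g) ` R)" using R by simp
    show "(\<lambda>a. a \<otimes> g) ` R \<subseteq> carrier G" using R LG g by auto
    show "g <# H \<subseteq> H <#> (\<lambda>a. a \<otimes> g) ` R"
    proof
      fix x assume x: "x \<in> g <# H"
      then have xG: "x \<in> carrier G" using HG g l_coset_subset_G by blast
      have xL: "x \<otimes> inv g \<in> L" using x by (auto simp: L_def r_coset_def)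
      then obtain a where a: "a \<in> R" "K #> (x \<otimes> inv g) = K #> a"
        using R(3) by (metis imageE imageI)
      have "x \<otimes> inv g \<in> K #> (x \<otimes> inv g)"
        using rcos_self[OF _ sK] xL LG by blast
      then obtain k where k: "k \<in> K" "x \<otimes> inv g = k \<otimes> a"
        using a by (auto simp: r_coset_def)
      have aG: "a \<in> carrier G" and kG: "k \<in> carrier G" using a R LG k KG by auto
      have "x = x \<otimes> inv g \<otimes> g" using xG g by (simp add: m_assoc)
      also have "\<dots> = k \<otimes> (a \<otimes> g)" using k aG kG g by (simp add: m_assoc)
      finally show "x \<in> H <#> (\<lambda>a. a \<otimes> g) ` R"
        using k a by (auto simp: set_mult_def K_def)
    qed
  qed
qed

end

context topological_group
begin

lemma continuous_map_left_mult:
  assumes "g \<in> carrier G"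
  shows "continuous_map T T (\<lambda>x. g \<otimes> x)"
proof -
  have "continuous_map T (prod_topology T T) (\<lambda>x. (g, x))"
    using assms by (auto intro!: continuous_map_pairedI simp: topspace_eq_carrier)
  from continuous_map_compose[OF this continuous_mult] show ?thesis
    by (simp add: o_def)
qed

text \<open>The translate is the preimage of \<open>U\<close> under left multiplication by
  \<open>inv g\<close>, which is continuous.\<close>

lemma openin_l_coset:
  assumes "openin T U" and g: "g \<in> carrier G"
  shows "openin T (g <# U)"
proof -
  have UG: "U \<subseteq> carrier G"
    using assms openin_subset topspace_eq_carrier by metis
  have "g <# U = {x \<in> topspace T. inv g \<otimes> x \<in> U}"
  proof (intro equalityI subsetI)
    fix x assume "x \<in> g <# U"
    then show "x \<in> {x \<in> topspace T. inv g \<otimes> x \<in> U}"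
      using UG g by (auto simp: l_coset_def topspace_eq_carrier m_assoc[symmetric] subsetD)
  next
    fix x assume x: "x \<in> {x \<in> topspace T. inv g \<otimes> x \<in> U}"
    then have "x = g \<otimes> (inv g \<otimes> x)"
      using g by (simp add: topspace_eq_carrier m_assoc[symmetric])
    with x show "x \<in> g <# U" by (auto simp: l_coset_def)
  qed
  then show ?thesis
    using openin_continuous_map_preimage[OF continuous_map_left_mult assms(1)] g by simp
qed

text \<open>The complement of \<open>H\<close> is a union of left cosets of \<open>H\<close>, each
  of them open. This supplies the closedness that \<open>almost_commutes_with_compacts\<close>
  demands.\<close>

lemma open_subgroup_closedin:
  assumes "subgroup H G" and "openin T H"
  shows "closedin T H"
proof -
  interpret H: subgroup H G by fact
  have "carrier G - H = (\<Union>g \<in> carrier G - H. g <# H)"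
  proof (intro equalityI subsetI)
    fix x assume x: "x \<in> carrier G - H"
    then have "x \<in> x <# H"
      using H.one_closed r_one by (force simp: l_coset_def)
    with x show "x \<in> (\<Union>g \<in> carrier G - H. g <# H)" by blast
  next
    fix x assume "x \<in> (\<Union>g \<in> carrier G - H. g <# H)"
    then obtain g h where g: "g \<in> carrier G" "g \<notin> H" and h: "h \<in> H" "x = g \<otimes> h"
      by (auto simp: l_coset_def)
    have "g \<in> H" if "x \<in> H"
    proof -
      have "g = x \<otimes> inv h" using g h by (simp add: m_assoc)
      then show ?thesis using that h(1) by blast
    qed
    with g h show "x \<in> carrier G - H" by (metis DiffI H.mem_carrier m_closed)
  qed
  moreover have "openin T (\<Union>g \<in> carrier G - H. g <# H)"
    using assms by (auto intro: openin_l_coset)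
  ultimately show ?thesis
    by (simp add: closedin_def topspace_eq_carrier H.subset)
qed

text \<open>Compactness leaves finitely many cosets \<open>g <# H\<close> covering \<open>C\<close>,
  with \<open>g\<close> in a finite set \<open>D \<subseteq> C\<close>. They also cover
  \<open>C <#> H\<close>, being stable under right multiplication by \<open>H\<close>, and each lies
  in \<open>H <#> F g\<close> for a finite \<open>F g\<close>.\<close>

lemma compactin_mult_commensurated_subset:
  assumes H: "commensurated G H" "openin T H" and C: "compactin T C"
  obtains F where "finite F" "F \<subseteq> carrier G" "C <#> H \<subseteq> H <#> F"
proof -
  have sH: "subgroup H G" using H by (simp add: commensurated_def)
  have CG: "C \<subseteq> carrier G"
    using compactin_subset_topspace[OF C] by (simp add: topspace_eq_carrier)
  have "x \<in> x <# H" if "x \<in> C" for x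
    using that CG subgroup.one_closed[OF sH] r_one by (force simp: l_coset_def)
  then have "C \<subseteq> \<Union>((\<lambda>g. g <# H) ` C)" by blast
  moreover have "openin T U" if "U \<in> (\<lambda>g. g <# H) ` C" for U
    using that CG H by (auto intro: openin_l_coset)
  ultimately obtain \<U> where "finite \<U>" "\<U> \<subseteq> (\<lambda>g. g <# H) ` C" "C \<subseteq> \<Union>\<U>"
    using C unfolding compactin_def by meson
  then obtain D where D: "D \<subseteq> C" "finite D" "C \<subseteq> (\<Union>g \<in> D. g <# H)"
    by (metis finite_subset_image)
  have "\<forall>g \<in> D. \<exists>F. finite F \<and> F \<subseteq> carrier G \<and> g <# H \<subseteq> H <#> F"
  proof
    fix g assume "g \<in> D"
    then have "g \<in> carrier G" using D CG by blast
    from commensurated_l_coset_subset[OF H(1) this]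
    show "\<exists>F. finite F \<and> F \<subseteq> carrier G \<and> g <# H \<subseteq> H <#> F" by metis
  qed
  then obtain F where
    F: "\<forall>g \<in> D. finite (F g) \<and> F g \<subseteq> carrier G \<and> g <# H \<subseteq> H <#> F g"
    by (rule bchoice[THEN exE])
  show thesis
  proof
    show "finite (\<Union>g \<in> D. F g)" "(\<Union>g \<in> D. F g) \<subseteq> carrier G"
      using D F by auto
    show "C <#> H \<subseteq> H <#> (\<Union>g \<in> D. F g)"
    proof
      fix x assume "x \<in> C <#> H"
      then obtain c h where x: "c \<in> C" "h \<in> H" "x = c \<otimes> h" by (auto simp: set_mult_def)
      with D obtain g l where g: "g \<in> D" "l \<in> H" "c = g \<otimes> l" by (auto simp: l_coset_def)
      \<comment> \<open>The factor \<open>h\<close> is absorbed into the coset of \<open>g\<close>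
        that contains \<open>c\<close>.\<close>
      have "x = g \<otimes> (l \<otimes> h)"
        using x g D CG subgroup.subset[OF sH] by (auto simp: m_assoc subsetD)
      then have "x \<in> g <# H"
        using x g subgroup.m_closed[OF sH] by (auto simp: l_coset_def)
      then have "x \<in> H <#> F g" using F g by blast
      with g show "x \<in> H <#> (\<Union>g \<in> D. F g)" by (auto simp: set_mult_def)
    qed
  qed
qed

text \<open>Inversion reverses products and fixes \<open>H\<close> as a set, so it turns the
  previous inclusion, applied to the inverses of \<open>C\<close>, into the mirrored one.\<close>

lemma commensurated_mult_compactin_subset:
  assumes H: "commensurated G H" "openin T H" and C: "compactin T C"
  obtains F where "finite F" "F \<subseteq> carrier G" "H <#> C \<subseteq> F <#> H"
proof -
  have sH: "subgroup H G" using H by (simp add: commensurated_def)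
  then have HG: "H \<subseteq> carrier G" by (rule subgroup.subset)
  have CG: "C \<subseteq> carrier G"
    using compactin_subset_topspace[OF C] by (simp add: topspace_eq_carrier)
  \<comment> \<open>Continuity of inversion keeps the set of inverses compact.\<close>
  have "compactin T ((\<lambda>x. inv x) ` C)"
    using image_compactin[OF C continuous_inv] .
  then obtain F where F: "finite F" "F \<subseteq> carrier G" "(\<lambda>x. inv x) ` C <#> H \<subseteq> H <#> F"
    by (rule compactin_mult_commensurated_subset[OF H])
  show thesis
  proof
    show "finite ((\<lambda>x. inv x) ` F)" "(\<lambda>x. inv x) ` F \<subseteq> carrier G" using F by auto
    show "H <#> C \<subseteq> (\<lambda>x. inv x) ` F <#> H"
    proof
      fix x assume "x \<in> H <#> C"
      then obtain h c where x: "h \<in> H" "c \<in> C" "x = h \<otimes> c" by (auto simp: set_mult_def)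
      then have hc: "h \<in> carrier G" "c \<in> carrier G" using HG CG by auto
      have "inv c \<otimes> inv h \<in> (\<lambda>x. inv x) ` C <#> H"
        using x subgroup.m_inv_closed[OF sH] by (auto simp: set_mult_def)
      then obtain l f where l: "l \<in> H" "f \<in> F" "inv c \<otimes> inv h = l \<otimes> f"
        using F(3) unfolding set_mult_def by blast
      then have lf: "l \<in> carrier G" "f \<in> carrier G" using HG F by auto
      have "x = inv (inv c \<otimes> inv h)" using x hc by (simp add: inv_mult_group)
      also have "\<dots> = inv f \<otimes> inv l" using l lf by (simp add: inv_mult_group)
      finally show "x \<in> (\<lambda>x. inv x) ` F <#> H"
        using l subgroup.m_inv_closed[OF sH] by (auto simp: set_mult_def)
    qed
  qed
qed

end

theorem proposition3p3:
  fixes G :: "('a, 'b) monoid_scheme" and T :: "'a topology" and \<Lambda> :: "'a set"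
  assumes "hecke_pair G T \<Lambda>"
    and "locally_compact_space T"
  shows "almost_commutes_with_compacts G T \<Lambda>"
proof -
  interpret hecke_pair G T \<Lambda> by fact
  have sub: "subgroup \<Lambda> G"
    using commensurated_subgroup by (simp add: commensurated_def)
  have "locally_compact_Hausdorff_group G T"
    using Hausdorff assms(2) by unfold_locales
  moreover have "\<exists>C'. compactin T C' \<and> C <#>\<^bsub>G\<^esub> \<Lambda> \<subseteq> \<Lambda> <#>\<^bsub>G\<^esub> C' \<and> \<Lambda> <#>\<^bsub>G\<^esub> C \<subseteq> C' <#>\<^bsub>G\<^esub> \<Lambda>"
    if C: "compactin T C" for C
  proof -
    obtain F1 where F1: "finite F1" "F1 \<subseteq> carrier G" "C <#>\<^bsub>G\<^esub> \<Lambda> \<subseteq> \<Lambda> <#>\<^bsub>G\<^esub> F1"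
      using compactin_mult_commensurated_subset[OF commensurated_subgroup open_subgroup C] .
    obtain F2 where F2: "finite F2" "F2 \<subseteq> carrier G" "\<Lambda> <#>\<^bsub>G\<^esub> C \<subseteq> F2 <#>\<^bsub>G\<^esub> \<Lambda>"
      using commensurated_mult_compactin_subset[OF commensurated_subgroup open_subgroup C] .
    \<comment> \<open>One compact set must serve both inclusions. The union is finite, hence
      compact, and enlarging \<open>F1\<close> or \<open>F2\<close> to it preserves the respective
      inclusion.\<close>
    have "compactin T (F1 \<union> F2)"
      using F1 F2 by (intro finite_imp_compactin) (auto simp: topspace_eq_carrier)
    moreover have "\<Lambda> <#>\<^bsub>G\<^esub> F1 \<subseteq> \<Lambda> <#>\<^bsub>G\<^esub> (F1 \<union> F2)" "F2 <#>\<^bsub>G\<^esub> \<Lambda> \<subseteq> (F1 \<union> F2) <#>\<^bsub>G\<^esub> \<Lambda>"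
      by (simp_all add: mono_set_mult)
    then have "C <#>\<^bsub>G\<^esub> \<Lambda> \<subseteq> \<Lambda> <#>\<^bsub>G\<^esub> (F1 \<union> F2)" "\<Lambda> <#>\<^bsub>G\<^esub> C \<subseteq> (F1 \<union> F2) <#>\<^bsub>G\<^esub> \<Lambda>"
      using F1(3) F2(3) by (meson order_trans)+
    ultimately show ?thesis by blast
  qed
  ultimately show ?thesis
    unfolding almost_commutes_with_compacts_def
    using sub open_subgroup_closedin[OF sub open_subgroup] by blast
qed

end
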